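(* Let $O=(Y,D,Z)$ with $Y,D\in\mathbb{R}$ and $Z=(Z_1,\dots,Z_p)\in\{0,1\}^p$ (row vector), $p\ge2$, $\mu^*=\mathbb{E}(Z)$. Assume: (ALICE model) There are potential outcomes $Y(d,z)$ with $Y=Y(D,Z)$ and parameters $\beta^*\in\mathbb{R}$, $\zeta^*,\psi^*\in\mathbb{R}^p$ such that $Y(d',z')-Y(d,z)=(d'-d)\beta^*+(z'-z)\zeta^*$ for all $d,d',z,z'$ and $\mathbb{E}\{Y(0,0)\mid Z\}=Z\psi^*$; write $\pi^*=\zeta^*+\psi^*$, so that $\mathbb{E}(Y-D\beta^*\mid Z)=Z\pi^*$. (Independent instruments) $Z_1,\dots,Z_p$ are mutually independent. (Interaction relevance) For fixed $2\le q\le p$ and $r=\sum_{k=2}^q\binom pk$ (held fixed, not growing with sample size), $M=-\mathbb{E}\{(\bar Z_{2,\mu^*}^\top,\dots,\bar Z_{q,\mu^*}^\top)^\top D\}\in\mathbb{R}^r$ is nonzero. Let $\bar m(O;\beta^*,\mu^*,\pi^* )=(\bar Z_{2,\mu^*}^\top,\dots,\bar Z_{q,\mu^*}^\top)^\top(Y-D\beta^*-Z\pi^* )$ and $\Omega=\mathbb{E}\{\bar m(O;\beta^*,\mu^*,\pi^* )\bar m(O;\beta^*,\mu^*,\pi^* )^\top\}$, assumed nonsingular. Consider the semiparametric model for $O$ defined by these assumptions (equivalently, by the moment restriction $\mathbb{E}\{(\bar Z_{2,\mu^*}^\top,\dots,\bar Z_{q,\mu^*}^\top)^\top(Y-D\beta)\}=0$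 identifying $\beta^*$), in which influence functions of regular asymptotically linear estimators of $\beta^*$ have the form $(\theta^\top M)^{-1}\theta^\top \bar m(O;\beta^*,\mu^*,\pi^* )$ for $\theta\in\mathbb{R}^r$ with $\theta^\top M\neq0$. Then the efficient influence function for $\beta^*$ is the one with $\theta=\theta_{\mathrm{opt}}=\Omega^{-1}M$, i.e. $(M^\top\Omega^{-1}M)^{-1}M^\top\Omega^{-1}\bar m(O;\beta^*,\mu^*,\pi^* )$, and the semiparametric efficiency bound for $\beta^*$ is $(M^\top\Omega^{-1}M)^{-1}$.
   Context: For $1\le k\le p$ and $\mu\in\mathbb{R}^p$, $\bar Z_{k,\mu}$ is the column vector (in a fixed order) of all demeaned $k$-th order interactions $\prod_{j\in x}(Z_j-\mu_j)$ over subsets $x\subseteq\{1,\dots,p\}$ with $|x|=k$. All expectations appearing are assumed finite. *)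

theory Defs
  imports "HOL-Probability.Probability"
begin

text \<open>Index set of all interactions of order 2..q among instruments 0..p-1
  (the paper's fixed ordering of these r subsets is irrelevant; vectors in R^r
  are represented as functions on this finite index set).\<close>
definition interaction_sets :: "nat \<Rightarrow> nat \<Rightarrow> nat set set" where
  "interaction_sets p q = {x. x \<subseteq> {..<p} \<and> 2 \<le> card x \<and> card x \<le> q}"

definition Zbar :: "('a \<Rightarrow> nat \<Rightarrow> real) \<Rightarrow> (nat \<Rightarrow> real) \<Rightarrow> nat set \<Rightarrow> 'a \<Rightarrow> real" where
  "Zbar Z \<mu> x \<omega> = (\<Prod>j\<in>x. Z \<omega> j - \<mu> j)"

definition gen_sigma :: "'a measure \<Rightarrow> ('a \<Rightarrow> nat \<Rightarrow> real) \<Rightarrow> nat \<Rightarrow> 'a measure" where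
  "gen_sigma M Z p = sigma (space M)
     {(\<lambda>\<omega>. Z \<omega> j) -` B \<inter> space M | j B. j < p \<and> B \<in> sets borel}"

definition mbar :: "('a \<Rightarrow> real) \<Rightarrow> ('a \<Rightarrow> real) \<Rightarrow> ('a \<Rightarrow> nat \<Rightarrow> real) \<Rightarrow> nat
    \<Rightarrow> real \<Rightarrow> (nat \<Rightarrow> real) \<Rightarrow> (nat \<Rightarrow> real) \<Rightarrow> nat set \<Rightarrow> 'a \<Rightarrow> real" where
  "mbar Y D Z p \<beta> \<mu> \<pi> x \<omega> =
     Zbar Z \<mu> x \<omega> * (Y \<omega> - D \<omega> * \<beta> - (\<Sum>j<p. Z \<omega> j * \<pi> j))"

definition IF_theta :: "nat set set \<Rightarrow> (nat set \<Rightarrow> real) \<Rightarrow> (nat set \<Rightarrow> 'a \<Rightarrow> real)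
    \<Rightarrow> (nat set \<Rightarrow> real) \<Rightarrow> 'a \<Rightarrow> real" where
  "IF_theta S Mv m \<theta> \<omega> = (\<Sum>x\<in>S. \<theta> x * m x \<omega>) / (\<Sum>x\<in>S. \<theta> x * Mv x)"

definition IF_class :: "nat set set \<Rightarrow> (nat set \<Rightarrow> real) \<Rightarrow> (nat set \<Rightarrow> 'a \<Rightarrow> real)
    \<Rightarrow> ('a \<Rightarrow> real) set" where
  "IF_class S Mv m = {IF_theta S Mv m \<theta> | \<theta>. (\<Sum>x\<in>S. \<theta> x * Mv x) \<noteq> 0}"

definition efficient_IF :: "'a measure \<Rightarrow> ('a \<Rightarrow> real) set \<Rightarrow> ('a \<Rightarrow> real) \<Rightarrow> bool" where
  "efficient_IF M \<Phi> \<phi> \<longleftrightarrow> \<phi> \<in> \<Phi> \<and>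
     (\<forall>\<psi>\<in>\<Phi>. integral\<^sup>L M (\<lambda>\<omega>. (\<phi> \<omega>)\<^sup>2) \<le> integral\<^sup>L M (\<lambda>\<omega>. (\<psi> \<omega>)\<^sup>2))"

end

theory Submission
  imports Defs "Jordan_Normal_Form.Determinant"
begin

text \<open>Write \<open>IF\<^sub>\<theta> = \<theta>\<^sup>T m / \<theta>\<^sup>T M\<close>. If \<open>\<Omega> \<theta>\<^sub>o\<^sub>p\<^sub>t = M\<close>, then
  \<open>E (\<theta>\<^sup>T m \<cdot> \<theta>\<^sub>o\<^sub>p\<^sub>t\<^sup>T m) = \<theta>\<^sup>T \<Omega> \<theta>\<^sub>o\<^sub>p\<^sub>t = \<theta>\<^sup>T M\<close>, so \<open>E (IF\<^sub>\<theta> IF\<^sub>\<theta>\<^sub>o\<^sub>p\<^sub>t) = 1 / \<theta>\<^sub>o\<^sub>p\<^sub>t\<^sup>T M\<close> does not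
  depend on the admissible \<open>\<theta>\<close>. Hence \<open>IF\<^sub>\<theta>\<^sub>o\<^sub>p\<^sub>t\<close> is orthogonal to every \<open>IF\<^sub>\<theta> - IF\<^sub>\<theta>\<^sub>o\<^sub>p\<^sub>t\<close>,
  and Pythagoras makes it the unique (up to null sets) member of minimal second moment
  \<open>1 / \<theta>\<^sub>o\<^sub>p\<^sub>t\<^sup>T M = (M\<^sup>T \<Omega>\<^sup>-\<^sup>1 M)\<^sup>-\<^sup>1\<close>. The pairing \<open>\<theta>\<^sub>o\<^sub>p\<^sub>t\<^sup>T M = E (\<theta>\<^sub>o\<^sub>p\<^sub>t\<^sup>T m)\<^sup>2\<close> cannot vanish,
  since \<open>\<theta>\<^sub>o\<^sub>p\<^sub>t\<^sup>T m = 0\<close> a.s. would give \<open>M = 0\<close>.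

  Binary instruments make the interactions bounded, so the second moments of \<open>m\<close> are finite
  once the residual is square integrable.\<close>

lemma mat_vec_eq_solvable_if_kernel_trivial:
  fixes A :: "'a :: field mat"
  assumes A: "A \<in> carrier_mat n n" and b: "b \<in> carrier_vec n"
    and ker: "\<And>v. v \<in> carrier_vec n \<Longrightarrow> A *\<^sub>v v = 0\<^sub>v n \<Longrightarrow> v = 0\<^sub>v n"
  shows "\<exists>u \<in> carrier_vec n. A *\<^sub>v u = b"
proof -
  have "det A \<noteq> 0"
    using det_0_iff_vec_prod_zero_field[OF A] ker by blast
  from det_non_zero_imp_unit[OF A this, unfolded Units_def, of "()"]
  obtain B where B: "B \<in> carrier_mat n n" and AB: "A * B = 1\<^sub>m n"
    by (auto simp: ring_mat_def)
  have "A *\<^sub>v (B *\<^sub>v b) = (A * B) *\<^sub>v b"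
    using A B b by (rule assoc_mult_mat_vec[symmetric])
  also have "\<dots> = b"
    unfolding AB using b by (rule one_mult_mat_vec)
  finally have "A *\<^sub>v (B *\<^sub>v b) = b" .
  moreover have "B *\<^sub>v b \<in> carrier_vec n"
    using B b by (rule mult_mat_vec_carrier)
  ultimately show ?thesis by blast
qed

lemma finite_linear_system_solvable:
  fixes A :: "'b \<Rightarrow> 'b \<Rightarrow> 'a :: field"
  assumes "finite S"
    and ker: "\<And>v. \<forall>x\<in>S. (\<Sum>y\<in>S. A x y * v y) = 0 \<Longrightarrow> \<forall>x\<in>S. v x = 0"
  shows "\<exists>v. \<forall>x\<in>S. (\<Sum>y\<in>S. A x y * v y) = b x"
proof -
  define n where "n = card S"
  obtain f where f: "bij_betw f {0..<n} S"
    using ex_bij_betw_nat_finite[OF \<open>finite S\<close>] unfolding n_def by blast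
  define g where "g = inv_into {0..<n} f"
  have g: "\<And>y. y \<in> S \<Longrightarrow> g y < n \<and> f (g y) = y"
    using f unfolding g_def bij_betw_def by (auto simp: f_inv_into_f inv_into_into)
  have gf: "\<And>i. i < n \<Longrightarrow> g (f i) = i"
    using f unfolding g_def bij_betw_def by auto
  define AS where "AS = mat n n (\<lambda>(i, j). A (f i) (f j))"
  have AS: "AS \<in> carrier_mat n n"
    unfolding AS_def by simp
  have mat_form: "(AS *\<^sub>v vec n (v \<circ> f)) $ i = (\<Sum>y\<in>S. A (f i) y * v y)" if "i < n" for v i
    using that sum.reindex_bij_betw[OF f, of "\<lambda>y. A (f i) y * v y"]
    by (simp add: AS_def scalar_prod_def atLeast0LessThan)
  have system_form: "(\<Sum>y\<in>S. A x y * w $ g y) = (AS *\<^sub>v w) $ g x"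
    if x: "x \<in> S" and w: "w \<in> carrier_vec n" for x w
  proof -
    have "vec n ((\<lambda>y. w $ g y) \<circ> f) = w"
      using w gf by (intro eq_vecI) auto
    then show ?thesis
      using mat_form[of "g x" "\<lambda>y. w $ g y"] g[OF x] by simp
  qed
  have "\<exists>u \<in> carrier_vec n. AS *\<^sub>v u = vec n (b \<circ> f)"
  proof (rule mat_vec_eq_solvable_if_kernel_trivial[OF AS])
    fix w :: "'a vec" assume w: "w \<in> carrier_vec n" "AS *\<^sub>v w = 0\<^sub>v n"
    have "\<forall>x\<in>S. (\<Sum>y\<in>S. A x y * w $ g y) = 0"
      using system_form w g by simp
    then have "\<forall>x\<in>S. w $ g x = 0"
      using ker[of "\<lambda>y. w $ g y"] by simp
    then have "w $ i = 0" if "i < n" for i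
      using bij_betw_apply[OF f] gf[OF that] that by force
    then show "w = 0\<^sub>v n"
      using w(1) by (intro eq_vecI) auto
  qed simp
  then obtain u where u: "u \<in> carrier_vec n" "AS *\<^sub>v u = vec n (b \<circ> f)" by blast
  show ?thesis
  proof
    show "\<forall>x\<in>S. (\<Sum>y\<in>S. A x y * u $ g y) = b x"
      using system_form[OF _ u(1)] u(2) g by simp
  qed
qed

lemma Zbar_abs_le:
  assumes "x \<subseteq> {..<p}" and "\<And>j. j < p \<Longrightarrow> Z \<omega> j \<in> {0, 1::real}"
  shows "\<bar>Zbar Z \<mu> x \<omega>\<bar> \<le> (\<Prod>j\<in>x. 1 + \<bar>\<mu> j\<bar>)"
proof -
  have "\<bar>Zbar Z \<mu> x \<omega>\<bar> = (\<Prod>j\<in>x. \<bar>Z \<omega> j - \<mu> j\<bar>)"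
    by (simp add: Zbar_def abs_prod)
  also have "\<dots> \<le> (\<Prod>j\<in>x. 1 + \<bar>\<mu> j\<bar>)"
  proof (rule prod_mono)
    fix j assume "j \<in> x"
    then have "Z \<omega> j \<in> {0, 1}"
      using assms by blast
    then show "0 \<le> \<bar>Z \<omega> j - \<mu> j\<bar> \<and> \<bar>Z \<omega> j - \<mu> j\<bar> \<le> 1 + \<bar>\<mu> j\<bar>"
      by auto
  qed
  finally show ?thesis .
qed

lemma integrable_mbar_mult:
  fixes Z :: "'a \<Rightarrow> nat \<Rightarrow> real"
  assumes x: "x \<subseteq> {..<p}" and y: "y \<subseteq> {..<p}"
    and Y: "Y \<in> borel_measurable M" and D: "D \<in> borel_measurable M"
    and Z: "\<And>j. j < p \<Longrightarrow> (\<lambda>\<omega>. Z \<omega> j) \<in> borel_measurable M"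
    and Z_bin: "\<And>\<omega> j. \<omega> \<in> space M \<Longrightarrow> j < p \<Longrightarrow> Z \<omega> j \<in> {0, 1}"
    and res_sq: "integrable M (\<lambda>\<omega>. (Y \<omega> - D \<omega> * \<beta> - (\<Sum>j<p. Z \<omega> j * \<pi> j))\<^sup>2)"
  shows "integrable M (\<lambda>\<omega>. mbar Y D Z p \<beta> \<mu> \<pi> x \<omega> * mbar Y D Z p \<beta> \<mu> \<pi> y \<omega>)"
proof (rule Bochner_Integration.integrable_bound)
  define R where "R = (\<lambda>\<omega>. Y \<omega> - D \<omega> * \<beta> - (\<Sum>j<p. Z \<omega> j * \<pi> j))"
  define C where "C = (\<lambda>x. \<Prod>j\<in>x. 1 + \<bar>\<mu> j\<bar>)"
  have mbar_eq: "\<And>x. mbar Y D Z p \<beta> \<mu> \<pi> x = (\<lambda>\<omega>. Zbar Z \<mu> x \<omega> * R \<omega>)"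
    unfolding mbar_def R_def by simp
  have Zbar_meas: "Zbar Z \<mu> x \<in> borel_measurable M" if "x \<subseteq> {..<p}" for x
    unfolding Zbar_def using Z that by (intro borel_measurable_prod) auto
  have "R \<in> borel_measurable M"
    unfolding R_def using Y D Z by measurable
  then show "(\<lambda>\<omega>. mbar Y D Z p \<beta> \<mu> \<pi> x \<omega> * mbar Y D Z p \<beta> \<mu> \<pi> y \<omega>) \<in> borel_measurable M"
    unfolding mbar_eq using Zbar_meas[OF x] Zbar_meas[OF y] by measurable
  show "integrable M (\<lambda>\<omega>. C x * C y * (R \<omega>)\<^sup>2)"
    using res_sq unfolding R_def by simp
  have C_nonneg: "0 \<le> C x" "0 \<le> C y"
    unfolding C_def by (auto intro: prod_nonneg)
  show "AE \<omega> in M. norm (mbar Y D Z p \<beta> \<mu> \<pi> x \<omega> * mbar Y D Z p \<beta> \<mu> \<pi> y \<omega>)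
                    \<le> norm (C x * C y * (R \<omega>)\<^sup>2)"
  proof (rule AE_I2)
    fix \<omega> assume \<omega>: "\<omega> \<in> space M"
    have "\<bar>Zbar Z \<mu> x \<omega>\<bar> \<le> C x"
      unfolding C_def using x Z_bin[OF \<omega>] by (rule Zbar_abs_le)
    moreover have "\<bar>Zbar Z \<mu> y \<omega>\<bar> \<le> C y"
      unfolding C_def using y Z_bin[OF \<omega>] by (rule Zbar_abs_le)
    moreover have "norm (mbar Y D Z p \<beta> \<mu> \<pi> x \<omega> * mbar Y D Z p \<beta> \<mu> \<pi> y \<omega>)
        = \<bar>Zbar Z \<mu> x \<omega>\<bar> * \<bar>Zbar Z \<mu> y \<omega>\<bar> * (R \<omega>)\<^sup>2"
      by (simp add: mbar_eq abs_mult power2_eq_square)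
    ultimately show "norm (mbar Y D Z p \<beta> \<mu> \<pi> x \<omega> * mbar Y D Z p \<beta> \<mu> \<pi> y \<omega>)
                 \<le> norm (C x * C y * (R \<omega>)\<^sup>2)"
      using C_nonneg by (simp add: mult_mono mult_right_mono)
  qed
qed

lemma integral_diff_square:
  fixes f g :: "'a \<Rightarrow> real"
  assumes "integrable M (\<lambda>\<omega>. (f \<omega>)\<^sup>2)" "integrable M (\<lambda>\<omega>. (g \<omega>)\<^sup>2)"
    and "integrable M (\<lambda>\<omega>. f \<omega> * g \<omega>)"
  shows "integrable M (\<lambda>\<omega>. (f \<omega> - g \<omega>)\<^sup>2)"
    and "(\<integral>\<omega>. (f \<omega> - g \<omega>)\<^sup>2 \<partial>M)
           = (\<integral>\<omega>. (f \<omega>)\<^sup>2 \<partial>M) - 2 * (\<integral>\<omega>. f \<omega> * g \<omega> \<partial>M) + (\<integral>\<omega>. (g \<omega>)\<^sup>2 \<partial>M)"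
proof -
  have expand: "(\<lambda>\<omega>. (f \<omega> - g \<omega>)\<^sup>2) = (\<lambda>\<omega>. (f \<omega>)\<^sup>2 - 2 * (f \<omega> * g \<omega>) + (g \<omega>)\<^sup>2)"
    by (simp add: power2_diff algebra_simps)
  show "integrable M (\<lambda>\<omega>. (f \<omega> - g \<omega>)\<^sup>2)"
    unfolding expand using assms by simp
  show "(\<integral>\<omega>. (f \<omega> - g \<omega>)\<^sup>2 \<partial>M)
          = (\<integral>\<omega>. (f \<omega>)\<^sup>2 \<partial>M) - 2 * (\<integral>\<omega>. f \<omega> * g \<omega> \<partial>M) + (\<integral>\<omega>. (g \<omega>)\<^sup>2 \<partial>M)"
    unfolding expand using assms by simp
qed

lemma
  fixes \<phi>\<^sub>0 :: "'a \<Rightarrow> real"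
  assumes "\<phi>\<^sub>0 \<in> \<Phi>"
    and sq_int: "\<And>\<phi>. \<phi> \<in> \<Phi> \<Longrightarrow> integrable M (\<lambda>\<omega>. (\<phi> \<omega>)\<^sup>2)"
    and mult_int: "\<And>\<phi>. \<phi> \<in> \<Phi> \<Longrightarrow> integrable M (\<lambda>\<omega>. \<phi> \<omega> * \<phi>\<^sub>0 \<omega>)"
    and orth: "\<And>\<phi>. \<phi> \<in> \<Phi> \<Longrightarrow> (\<integral>\<omega>. \<phi> \<omega> * \<phi>\<^sub>0 \<omega> \<partial>M) = (\<integral>\<omega>. (\<phi>\<^sub>0 \<omega>)\<^sup>2 \<partial>M)"
  shows efficient_IF_if_orthogonal: "efficient_IF M \<Phi> \<phi>\<^sub>0"
    and efficient_IF_unique_if_orthogonal: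
      "\<And>\<phi>. efficient_IF M \<Phi> \<phi> \<Longrightarrow> AE \<omega> in M. \<phi> \<omega> = \<phi>\<^sub>0 \<omega>"
proof -
  have diff: "integrable M (\<lambda>\<omega>. (\<phi> \<omega> - \<phi>\<^sub>0 \<omega>)\<^sup>2)"
    "(\<integral>\<omega>. (\<phi> \<omega> - \<phi>\<^sub>0 \<omega>)\<^sup>2 \<partial>M) = (\<integral>\<omega>. (\<phi> \<omega>)\<^sup>2 \<partial>M) - (\<integral>\<omega>. (\<phi>\<^sub>0 \<omega>)\<^sup>2 \<partial>M)"
    if "\<phi> \<in> \<Phi>" for \<phi>
    using integral_diff_square[OF sq_int[OF that] sq_int[OF \<open>\<phi>\<^sub>0 \<in> \<Phi>\<close>] mult_int[OF that]]
      orth[OF that] by simp_all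
  have diff_nonneg: "0 \<le> (\<integral>\<omega>. (\<phi> \<omega> - \<phi>\<^sub>0 \<omega>)\<^sup>2 \<partial>M)" for \<phi>
    by (rule integral_nonneg_AE) simp
  show "efficient_IF M \<Phi> \<phi>\<^sub>0"
    unfolding efficient_IF_def
  proof (intro conjI ballI)
    fix \<phi> assume "\<phi> \<in> \<Phi>"
    then show "(\<integral>\<omega>. (\<phi>\<^sub>0 \<omega>)\<^sup>2 \<partial>M) \<le> (\<integral>\<omega>. (\<phi> \<omega>)\<^sup>2 \<partial>M)"
      using diff(2) diff_nonneg[of \<phi>] by simp
  qed (fact \<open>\<phi>\<^sub>0 \<in> \<Phi>\<close>)
  fix \<phi> assume "efficient_IF M \<Phi> \<phi>"
  then have "\<phi> \<in> \<Phi>" "(\<integral>\<omega>. (\<phi> \<omega>)\<^sup>2 \<partial>M) \<le> (\<integral>\<omega>. (\<phi>\<^sub>0 \<omega>)\<^sup>2 \<partial>M)"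
    unfolding efficient_IF_def using \<open>\<phi>\<^sub>0 \<in> \<Phi>\<close> by auto
  then have "(\<integral>\<omega>. (\<phi> \<omega> - \<phi>\<^sub>0 \<omega>)\<^sup>2 \<partial>M) = 0"
    using diff(2) diff_nonneg[of \<phi>] by simp
  then have "AE \<omega> in M. (\<phi> \<omega> - \<phi>\<^sub>0 \<omega>)\<^sup>2 = 0"
    using integral_nonneg_eq_0_iff_AE[OF diff(1)[OF \<open>\<phi> \<in> \<Phi>\<close>]] by simp
  then show "AE \<omega> in M. \<phi> \<omega> = \<phi>\<^sub>0 \<omega>"
    by eventually_elim simp
qed

context
  fixes M :: "'a measure" and S :: "nat set set" and m :: "nat set \<Rightarrow> 'a \<Rightarrow> real"
  assumes mult_int: "\<And>x y. x \<in> S \<Longrightarrow> y \<in> S \<Longrightarrow> integrable M (\<lambda>\<omega>. m x \<omega> * m y \<omega>)"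
begin

lemma integral_mult_lincomb:
  assumes "x \<in> S"
  shows "integrable M (\<lambda>\<omega>. m x \<omega> * (\<Sum>y\<in>S. b y * m y \<omega>))"
    and "(\<integral>\<omega>. m x \<omega> * (\<Sum>y\<in>S. b y * m y \<omega>) \<partial>M) = (\<Sum>y\<in>S. (\<integral>\<omega>. m x \<omega> * m y \<omega> \<partial>M) * b y)"
proof -
  have expand: "(\<lambda>\<omega>. m x \<omega> * (\<Sum>y\<in>S. b y * m y \<omega>)) = (\<lambda>\<omega>. \<Sum>y\<in>S. b y * (m x \<omega> * m y \<omega>))"
    by (simp add: sum_distrib_left algebra_simps)
  show "integrable M (\<lambda>\<omega>. m x \<omega> * (\<Sum>y\<in>S. b y * m y \<omega>))"
    unfolding expand using assms mult_int by auto
  show "(\<integral>\<omega>. m x \<omega> * (\<Sum>y\<in>S. b y * m y \<omega>) \<partial>M) = (\<Sum>y\<in>S. (\<integral>\<omega>. m x \<omega> * m y \<omega> \<partial>M) * b y)"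
    unfolding expand using assms mult_int by (simp add: mult.commute)
qed

lemma integral_lincomb_mult:
  shows "integrable M (\<lambda>\<omega>. (\<Sum>x\<in>S. a x * m x \<omega>) * (\<Sum>y\<in>S. b y * m y \<omega>))"
    and "(\<integral>\<omega>. (\<Sum>x\<in>S. a x * m x \<omega>) * (\<Sum>y\<in>S. b y * m y \<omega>) \<partial>M)
           = (\<Sum>x\<in>S. a x * (\<Sum>y\<in>S. (\<integral>\<omega>. m x \<omega> * m y \<omega> \<partial>M) * b y))"
proof -
  have expand: "(\<lambda>\<omega>. (\<Sum>x\<in>S. a x * m x \<omega>) * (\<Sum>y\<in>S. b y * m y \<omega>))
      = (\<lambda>\<omega>. \<Sum>x\<in>S. a x * (m x \<omega> * (\<Sum>y\<in>S. b y * m y \<omega>)))"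
    by (simp add: sum_distrib_right algebra_simps)
  show "integrable M (\<lambda>\<omega>. (\<Sum>x\<in>S. a x * m x \<omega>) * (\<Sum>y\<in>S. b y * m y \<omega>))"
    unfolding expand using integral_mult_lincomb(1) by auto
  show "(\<integral>\<omega>. (\<Sum>x\<in>S. a x * m x \<omega>) * (\<Sum>y\<in>S. b y * m y \<omega>) \<partial>M)
          = (\<Sum>x\<in>S. a x * (\<Sum>y\<in>S. (\<integral>\<omega>. m x \<omega> * m y \<omega> \<partial>M) * b y))"
    unfolding expand using integral_mult_lincomb by simp
qed

lemma integrable_IF_theta_mult:
  "integrable M (\<lambda>\<omega>. IF_theta S Mv m a \<omega> * IF_theta S Mv m b \<omega>)"
  using integral_lincomb_mult(1)[of a b]
  by (simp add: IF_theta_def)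

context
  fixes Mv \<theta> :: "nat set \<Rightarrow> real"
  assumes gram_eq: "\<forall>x\<in>S. (\<Sum>y\<in>S. (\<integral>\<omega>. m x \<omega> * m y \<omega> \<partial>M) * \<theta> y) = Mv x"
begin

lemma integral_lincomb_mult_gram_solution:
  "(\<integral>\<omega>. (\<Sum>x\<in>S. a x * m x \<omega>) * (\<Sum>y\<in>S. \<theta> y * m y \<omega>) \<partial>M) = (\<Sum>x\<in>S. a x * Mv x)"
  using integral_lincomb_mult(2)[of a \<theta>] gram_eq by simp

lemma gram_solution_pairing_nonzero:
  assumes "\<exists>x\<in>S. Mv x \<noteq> 0"
  shows "(\<Sum>x\<in>S. \<theta> x * Mv x) \<noteq> 0"
proof
  define s where "s = (\<lambda>\<omega>. \<Sum>y\<in>S. \<theta> y * m y \<omega>)"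
  assume "(\<Sum>x\<in>S. \<theta> x * Mv x) = 0"
  then have "(\<integral>\<omega>. s \<omega> * s \<omega> \<partial>M) = 0"
    unfolding s_def integral_lincomb_mult_gram_solution .
  then have "AE \<omega> in M. s \<omega> * s \<omega> = 0"
    using integral_nonneg_eq_0_iff_AE[OF integral_lincomb_mult(1)[of \<theta> \<theta>]] unfolding s_def by simp
  then have "AE \<omega> in M. m x \<omega> * s \<omega> = 0" for x
    by eventually_elim simp
  then have "(\<integral>\<omega>. m x \<omega> * s \<omega> \<partial>M) = 0" for x
    by (simp add: integral_eq_zero_AE)
  then have "Mv x = 0" if "x \<in> S" for x
    using integral_mult_lincomb(2)[OF that, of \<theta>] gram_eq that unfolding s_def by simp
  with assms show False by blast
qed

lemma integral_IF_theta_mult_gram_solution: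
  assumes "(\<Sum>x\<in>S. a x * Mv x) \<noteq> 0"
  shows "(\<integral>\<omega>. IF_theta S Mv m a \<omega> * IF_theta S Mv m \<theta> \<omega> \<partial>M) = 1 / (\<Sum>x\<in>S. \<theta> x * Mv x)"
  using integral_lincomb_mult_gram_solution[of a] assms
  by (simp add: IF_theta_def)

lemma efficient_IF_theta_gram_solution:
  assumes Mv_nonzero: "\<exists>x\<in>S. Mv x \<noteq> 0"
  shows "efficient_IF M (IF_class S Mv m) (IF_theta S Mv m \<theta>)"
    and "\<And>\<phi>. efficient_IF M (IF_class S Mv m) \<phi> \<Longrightarrow> AE \<omega> in M. \<phi> \<omega> = IF_theta S Mv m \<theta> \<omega>"
    and "(\<integral>\<omega>. (IF_theta S Mv m \<theta> \<omega>)\<^sup>2 \<partial>M) = 1 / (\<Sum>x\<in>S. \<theta> x * Mv x)"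
proof -
  note pairing = gram_solution_pairing_nonzero[OF Mv_nonzero]
  have variance: "(\<integral>\<omega>. (IF_theta S Mv m \<theta> \<omega>)\<^sup>2 \<partial>M) = 1 / (\<Sum>x\<in>S. \<theta> x * Mv x)"
    using integral_IF_theta_mult_gram_solution[OF pairing] by (simp add: power2_eq_square)
  have in_class: "IF_theta S Mv m \<theta> \<in> IF_class S Mv m"
    unfolding IF_class_def using pairing by blast
  have members: "\<phi> \<in> IF_class S Mv m \<longleftrightarrow> (\<exists>a. (\<Sum>x\<in>S. a x * Mv x) \<noteq> 0 \<and> \<phi> = IF_theta S Mv m a)"
    for \<phi> unfolding IF_class_def by blast
  have "integrable M (\<lambda>\<omega>. (\<phi> \<omega>)\<^sup>2)" "integrable M (\<lambda>\<omega>. \<phi> \<omega> * IF_theta S Mv m \<theta> \<omega>)"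
    "(\<integral>\<omega>. \<phi> \<omega> * IF_theta S Mv m \<theta> \<omega> \<partial>M) = (\<integral>\<omega>. (IF_theta S Mv m \<theta> \<omega>)\<^sup>2 \<partial>M)"
    if "\<phi> \<in> IF_class S Mv m" for \<phi>
    using that integrable_IF_theta_mult integral_IF_theta_mult_gram_solution variance
    unfolding members power2_eq_square by auto
  then show "efficient_IF M (IF_class S Mv m) (IF_theta S Mv m \<theta>)"
    and "\<And>\<phi>. efficient_IF M (IF_class S Mv m) \<phi> \<Longrightarrow> AE \<omega> in M. \<phi> \<omega> = IF_theta S Mv m \<theta> \<omega>"
    using efficient_IF_if_orthogonal efficient_IF_unique_if_orthogonal in_class by blast+
  show "(\<integral>\<omega>. (IF_theta S Mv m \<theta> \<omega>)\<^sup>2 \<partial>M) = 1 / (\<Sum>x\<in>S. \<theta> x * Mv x)"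
    by (fact variance)
qed

end

end

theorem theorem2:
  fixes M :: "'a measure"
    and Y D :: "'a \<Rightarrow> real"
    and Z :: "'a \<Rightarrow> nat \<Rightarrow> real"
    and Yp :: "real \<Rightarrow> (nat \<Rightarrow> real) \<Rightarrow> 'a \<Rightarrow> real"
    and p q :: nat
    and \<beta> :: real
    and \<zeta> \<psi> \<pi> \<mu> :: "nat \<Rightarrow> real"
  defines "S \<equiv> interaction_sets p q"
      and "m \<equiv> mbar Y D Z p \<beta> \<mu> \<pi>"
      and "Mv \<equiv> (\<lambda>x. - prob_space.expectation M (\<lambda>\<omega>. Zbar Z \<mu> x \<omega> * D \<omega>))"
      and "\<Omega> \<equiv> (\<lambda>x y. prob_space.expectation M (\<lambda>\<omega>. mbar Y D Z p \<beta> \<mu> \<pi> x \<omega> * mbar Y D Z p \<beta> \<mu> \<pi> y \<omega>))"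
  assumes P: "prob_space M"
    and p2: "2 \<le> p" and q2: "2 \<le> q" and qp: "q \<le> p"
    and Y_rv: "Y \<in> borel_measurable M" and D_rv: "D \<in> borel_measurable M"
    and Z_rv: "\<And>j. j < p \<Longrightarrow> (\<lambda>\<omega>. Z \<omega> j) \<in> borel_measurable M"
    and Z_bin: "\<And>\<omega> j. \<omega> \<in> space M \<Longrightarrow> j < p \<Longrightarrow> Z \<omega> j \<in> {0, 1}"
    and mu_def: "\<And>j. j < p \<Longrightarrow> \<mu> j = prob_space.expectation M (\<lambda>\<omega>. Z \<omega> j)"
    \<comment> \<open>ALICE model\<close>
    and Yp_rv: "\<And>d z. Yp d z \<in> borel_measurable M"
    and consist: "\<And>\<omega>. \<omega> \<in> space M \<Longrightarrow> Y \<omega> = Yp (D \<omega>) (Z \<omega>) \<omega>"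
    and alice: "\<And>\<omega> d d' z z'. \<omega> \<in> space M \<Longrightarrow>
        (\<forall>j<p. z j \<in> {0, 1}) \<Longrightarrow> (\<forall>j<p. z' j \<in> {0, 1}) \<Longrightarrow>
        Yp d' z' \<omega> - Yp d z \<omega> = (d' - d) * \<beta> + (\<Sum>j<p. (z' j - z j) * \<zeta> j)"
    and Y00_int: "integrable M (Yp 0 (\<lambda>_. 0))"
    and cond_Y00: "AE \<omega> in M. real_cond_exp M (gen_sigma M Z p) (Yp 0 (\<lambda>_. 0)) \<omega>
                     = (\<Sum>j<p. Z \<omega> j * \<psi> j)"
    and pi_def: "\<And>j. \<pi> j = \<zeta> j + \<psi> j"
    \<comment> \<open>finiteness of the expectations appearing\<close>
    and D_int: "integrable M D"
    and res_sq_int: "integrable M (\<lambda>\<omega>. (Y \<omega> - D \<omega> * \<beta> - (\<Sum>j<p. Z \<omega> j * \<pi> j))\<^sup>2)"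
    \<comment> \<open>independent instruments\<close>
    and indep: "prob_space.indep_vars M (\<lambda>_. borel) (\<lambda>j \<omega>. Z \<omega> j) {..<p}"
    \<comment> \<open>interaction relevance\<close>
    and M_nz: "\<exists>x\<in>S. Mv x \<noteq> 0"
    \<comment> \<open>Omega nonsingular\<close>
    and Omega_nonsing: "\<And>v. (\<forall>x\<in>S. (\<Sum>y\<in>S. \<Omega> x y * v y) = 0) \<Longrightarrow> (\<forall>x\<in>S. v x = 0)"
  shows "(\<exists>\<theta>opt. \<forall>x\<in>S. (\<Sum>y\<in>S. \<Omega> x y * \<theta>opt y) = Mv x) \<and>
    (\<forall>\<theta>opt. (\<forall>x\<in>S. (\<Sum>y\<in>S. \<Omega> x y * \<theta>opt y) = Mv x) \<longrightarrow>
       (\<Sum>x\<in>S. \<theta>opt x * Mv x) \<noteq> 0 \<and>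
       efficient_IF M (IF_class S Mv m) (IF_theta S Mv m \<theta>opt) \<and>
       (\<forall>\<phi>. efficient_IF M (IF_class S Mv m) \<phi> \<longrightarrow>
            (AE \<omega> in M. \<phi> \<omega> = IF_theta S Mv m \<theta>opt \<omega>)) \<and>
       prob_space.expectation M (\<lambda>\<omega>. (IF_theta S Mv m \<theta>opt \<omega>)\<^sup>2)
         = 1 / (\<Sum>x\<in>S. \<theta>opt x * Mv x))"
proof -
  have S_sub: "x \<subseteq> {..<p}" if "x \<in> S" for x
    using that unfolding S_def interaction_sets_def by blast
  have S_fin: "finite S"
    using S_sub by (intro finite_subset[of S "Pow {..<p}"]) auto
  have mult_int: "integrable M (\<lambda>\<omega>. m x \<omega> * m y \<omega>)" if "x \<in> S" "y \<in> S" for x y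
    unfolding m_def using integrable_mbar_mult S_sub that Y_rv D_rv Z_rv Z_bin res_sq_int by blast
  have \<Omega>_eq: "\<Omega> = (\<lambda>x y. \<integral>\<omega>. m x \<omega> * m y \<omega> \<partial>M)"
    unfolding \<Omega>_def m_def ..
  obtain \<theta>\<^sub>0 where "\<forall>x\<in>S. (\<Sum>y\<in>S. \<Omega> x y * \<theta>\<^sub>0 y) = Mv x"
    using finite_linear_system_solvable[where A = \<Omega>, OF S_fin Omega_nonsing] by blast
  moreover have "(\<Sum>x\<in>S. \<theta> x * Mv x) \<noteq> 0 \<and>
      efficient_IF M (IF_class S Mv m) (IF_theta S Mv m \<theta>) \<and>
      (\<forall>\<phi>. efficient_IF M (IF_class S Mv m) \<phi> \<longrightarrow> (AE \<omega> in M. \<phi> \<omega> = IF_theta S Mv m \<theta> \<omega>)) \<and>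
      (\<integral>\<omega>. (IF_theta S Mv m \<theta> \<omega>)\<^sup>2 \<partial>M) = 1 / (\<Sum>x\<in>S. \<theta> x * Mv x)"
    if "\<forall>x\<in>S. (\<Sum>y\<in>S. \<Omega> x y * \<theta> y) = Mv x" for \<theta>
  proof -
    have gram: "\<forall>x\<in>S. (\<Sum>y\<in>S. (\<integral>\<omega>. m x \<omega> * m y \<omega> \<partial>M) * \<theta> y) = Mv x"
      using that unfolding \<Omega>_eq .
    show ?thesis
      using gram_solution_pairing_nonzero[where M = M and S = S and m = m, OF mult_int gram M_nz]
        efficient_IF_theta_gram_solution[where M = M and S = S and m = m, OF mult_int gram M_nz]
      by blast
  qed
  ultimately show ?thesis
    by blast
qed

end
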